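(* Let $n\ge2$ and let $G=(V,E)$ be a connected loopless undirected graph with $V=\{1,\dots,n\}$. Then $G$ is a complete bipartite graph if and only if $\mathcal P(\mathcal S^n_{1+})$ is closed.
   Context: $\mathcal S^n$ is the space of real symmetric $n\times n$ matrices and $\mathcal S^n_{1+}\subseteq\mathcal S^n$ is the set of positive semidefinite matrices of rank at most $1$. The graph $G=(V,E)$ has index set $E\subseteq\{ij: 1\le i\le j\le n\}$; loopless means $ii\notin E$ for all $i$. $\mathcal P:\mathcal S^n\to\mathbb R^E$ is the coordinate projection $\mathcal P(X)=(X_{ij})_{ij\in E}$, and $\mathcal P(\mathcal S^n_{1+})$ is the image of $\mathcal S^n_{1+}$; closedness is in the Euclidean space $\mathbb R^E$. $G$ is complete bipartite if $V$ is the disjoint union of two nonempty sets such that the edges are exactly the pairs with one vertex in each set. *)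

theory Defs
  imports "HOL-Analysis.Analysis"
begin

text \<open>
  The vertex set is the whole of a finite linearly ordered type, playing the role of
  \<open>{1, \<dots>, n}\<close> with \<open>n = CARD('n)\<close>.  An undirected graph is given by its index set of
  ordered pairs \<open>(i, j)\<close> with \<open>i \<le> j\<close>, so that each edge occurs once as a coordinate.
\<close>

definition graph_index_set :: "('n::{finite,linorder} \<times> 'n) set \<Rightarrow> bool" where
  "graph_index_set E \<longleftrightarrow> E \<subseteq> {(i, j). i \<le> j}"

definition loopless :: "('n \<times> 'n) set \<Rightarrow> bool" where
  "loopless E \<longleftrightarrow> (\<forall>i. (i, i) \<notin> E)"

definition adjacency :: "('n \<times> 'n) set \<Rightarrow> ('n \<times> 'n) set" where
  "adjacency E = E \<union> E\<inverse>"

definition connected_graph :: "('n \<times> 'n) set \<Rightarrow> bool" where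
  "connected_graph E \<longleftrightarrow> (\<forall>i j. (i, j) \<in> (adjacency E)\<^sup>*)"

definition complete_bipartite :: "('n \<times> 'n) set \<Rightarrow> bool" where
  "complete_bipartite E \<longleftrightarrow>
     (\<exists>U W. U \<noteq> {} \<and> W \<noteq> {} \<and> U \<inter> W = {} \<and> U \<union> W = UNIV \<and>
       adjacency E = U \<times> W \<union> W \<times> U)"

definition symmetric_matrices :: "(real ^ 'n ^ 'n) set" where
  "symmetric_matrices = {X. transpose X = X}"

definition positive_semidefinite :: "real ^ 'n ^ 'n \<Rightarrow> bool" where
  "positive_semidefinite X \<longleftrightarrow> (\<forall>v. 0 \<le> v \<bullet> (X *v v))"

definition psd_rank_le_one :: "(real ^ 'n ^ 'n) set" where
  "psd_rank_le_one =
     {X \<in> symmetric_matrices. positive_semidefinite X \<and> rank X \<le> 1}"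

text \<open>
  Points of \<open>\<real>\<^sup>E\<close> are functions that are \<open>undefined\<close> outside \<open>E\<close>; these form the underlying
  set of \<^term>\<open>powertop_real E\<close>, whose topology is the Euclidean one since \<open>E\<close> is finite.
\<close>

definition coord_proj :: "('n \<times> 'n) set \<Rightarrow> real ^ 'n ^ 'n \<Rightarrow> ('n \<times> 'n \<Rightarrow> real)" where
  "coord_proj E X = (\<lambda>(i, j)\<in>E. X $ i $ j)"

end

theory Submission
  imports Defs
begin

text \<open>
  A loopless connected graph is complete bipartite iff the endpoints of every walk
  \<open>a, b, c, d\<close> of length three are adjacent (closed walks \<open>a = d\<close> included, which excludes
  triangles).  If some such walk has nonadjacent endpoints, put the value \<open>t\<close> on \<open>{a, d}\<close>,
  \<open>1/t\<close> on \<open>{b, c}\<close> and \<open>0\<close> elsewhere: no edge has both ends in \<open>{a, d}\<close>, so the projections of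
  these rank one matrices converge as \<open>t \<rightarrow> \<infinity>\<close>, with limit \<open>1\<close> at \<open>ab\<close> and \<open>cd\<close> but \<open>0\<close> at \<open>bc\<close>,
  which no \<open>x x\<^sup>T\<close> attains.  Conversely, for a complete bipartite graph the image is cut out by
  the vanishing of the \<open>2 \<times> 2\<close> minors of the \<open>U \<times> W\<close> block.
\<close>

section \<open>Positive semidefinite matrices of rank at most one as outer products\<close>

definition outer :: "real ^ 'n \<Rightarrow> real ^ 'n ^ 'n" where
  "outer x = (\<chi> i j. x $ i * x $ j)"

text \<open>Each edge is stored only with its smaller endpoint first, so the coordinate of an
  unordered pair is found by sorting.\<close>

definition edge_coord :: "'n::linorder \<Rightarrow> 'n \<Rightarrow> 'n \<times> 'n" where
  "edge_coord i j = (if i \<le> j then (i, j) else (j, i))"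

lemma outer_nth [simp]: "outer x $ i $ j = x $ i * x $ j"
  by (simp add: outer_def)

lemma rank_one_factorization:
  fixes X :: "real ^ 'n ^ 'm"
  assumes "rank X \<le> 1"
  obtains c v where "\<And>i j. X $ i $ j = c i * v $ j"
proof -
  obtain B where B: "B \<subseteq> rows X" "independent B" "rows X \<subseteq> span B" "card B = dim (rows X)"
    using basis_exists by blast
  have "card B \<le> 1"
    using assms B(4) by (simp add: row_rank_def)
  moreover have "finite B"
    using B(2) by (rule independent_imp_finite)
  \<comment> \<open>The basis may be empty (zero matrix); then any \<open>v\<close> serves, which is
    why only an inclusion is claimed.\<close>
  ultimately obtain v where "B \<subseteq> {v}"
    by (metis card_le_Suc0_iff_eq One_nat_def insert_iff subsetI)
  then have "rows X \<subseteq> span {v}"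
    using B(3) span_mono by blast
  then have "\<forall>i. \<exists>c. row i X = c *\<^sub>R v"
    unfolding span_singleton rows_def by blast
  then obtain c where c: "\<And>i. row i X = c i *\<^sub>R v"
    by metis
  have "X $ i $ j = c i * v $ j" for i j
    using arg_cong[OF c[of i], of "\<lambda>r. r $ j"] by (simp add: row_def)
  then show thesis
    by (rule that)
qed

lemma positive_semidefinite_diagonal:
  assumes "positive_semidefinite X"
  shows "0 \<le> X $ k $ k"
proof -
  have "0 \<le> axis k 1 \<bullet> (X *v axis k 1)"
    using assms by (simp add: positive_semidefinite_def)
  then show ?thesis
    by (simp add: matrix_vector_mult_basis inner_axis' column_def)
qed

text \<open>Symmetry makes the two factors of a rank one matrix proportional, and a diagonal entry
  shows that the ratio is nonnegative, so its square root can be absorbed into the vector.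
  Conversely, the quadratic form of an outer product is a square.\<close>

lemma psd_rank_le_one_eq_range_outer:
  "psd_rank_le_one = range (outer :: real ^ 'n \<Rightarrow> real ^ 'n ^ 'n)"
proof (intro subset_antisym subsetI)
  fix X :: "real ^ 'n ^ 'n"
  assume "X \<in> psd_rank_le_one"
  then have sym: "transpose X = X" and psd: "positive_semidefinite X" and "rank X \<le> 1"
    by (auto simp: psd_rank_le_one_def symmetric_matrices_def)
  then obtain c v where cv: "\<And>i j. X $ i $ j = c i * v $ j"
    using rank_one_factorization by blast
  have sym_cv: "c i * v $ j = c j * v $ i" for i j
    using arg_cong[OF sym, of "\<lambda>Y. Y $ j $ i"] by (simp add: transpose_def cv)
  show "X \<in> range outer"
  proof (cases "v = 0")
    case True
    then have "X = outer 0"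
      by (simp add: vec_eq_iff cv)
    then show ?thesis
      by blast
  next
    case False
    then obtain k where k: "v $ k \<noteq> 0"
      by (auto simp: vec_eq_iff)
    \<comment> \<open>Symmetry at the index \<open>k\<close> gives
      \<open>c i * v $ k = c k * v $ i\<close>, that is, \<open>c i = s * v $ i\<close>.\<close>
    define s where "s = c k / v $ k"
    have X: "X $ i $ j = s * (v $ i * v $ j)" for i j
      using sym_cv[of i k] k by (simp add: cv s_def field_simps)
    have "0 \<le> s * (v $ k * v $ k)"
      using positive_semidefinite_diagonal[OF psd, of k] by (simp add: X)
    then have "0 \<le> s"
      using k by (simp add: zero_le_mult_iff mult_le_0_iff) linarith
    have "X $ i $ j = outer (sqrt s *\<^sub>R v) $ i $ j" for i j
    proof -
      have "(sqrt s * v $ i) * (sqrt s * v $ j) = (sqrt s * sqrt s) * (v $ i * v $ j)"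
        by (simp only: ac_simps)
      then show ?thesis
        using \<open>0 \<le> s\<close> by (simp add: X)
    qed
    then have "X = outer (sqrt s *\<^sub>R v)"
      by (simp only: vec_eq_iff) simp
    then show ?thesis
      by blast
  qed
next
  fix X :: "real ^ 'n ^ 'n"
  assume "X \<in> range outer"
  then obtain x where x: "X = outer x"
    by blast
  have "row i X = x $ i *\<^sub>R x" for i
    by (simp add: x row_def vec_eq_iff)
  then have "rows X \<subseteq> span {x}"
    by (auto simp: rows_def span_singleton)
  then have "rank X \<le> 1"
    using dim_le_card[of "rows X" "{x}"] by (simp add: row_rank_def)
  moreover have "v \<bullet> (X *v v) = (v \<bullet> x)\<^sup>2" for v
    by (simp add: x inner_vec_def matrix_vector_mult_def power2_eq_square sum_product
        sum_distrib_left algebra_simps)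
  ultimately show "X \<in> psd_rank_le_one"
    by (simp add: psd_rank_le_one_def symmetric_matrices_def positive_semidefinite_def
        x transpose_def vec_eq_iff mult.commute)
qed

lemma adjacency_sym: "(a, b) \<in> adjacency E \<longleftrightarrow> (b, a) \<in> adjacency E"
  by (auto simp: adjacency_def)

lemma adjacency_irrefl: "loopless E \<Longrightarrow> (a, a) \<notin> adjacency E"
  by (auto simp: adjacency_def loopless_def)

lemma edge_coord_mem:
  assumes "graph_index_set E" and "(a, b) \<in> adjacency E"
  shows "edge_coord a b \<in> E"
  using assms by (auto simp: edge_coord_def adjacency_def graph_index_set_def)

lemma coord_proj_outer_edge_coord:
  assumes "edge_coord a b \<in> E"
  shows "coord_proj E (outer x) (edge_coord a b) = x $ a * x $ b"
  using assms by (auto simp: edge_coord_def coord_proj_def)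

section \<open>A closed image forces a complete bipartite graph\<close>

text \<open>For an edge \<open>pw\<close>, the neighbourhoods of \<open>w\<close> and of
  \<open>p\<close> are the two sides: closing walks makes every edge cross between them, and
  connectedness makes them cover all vertices.\<close>

lemma complete_bipartite_if_walks_close:
  assumes "CARD('n) \<ge> 2"
    and "loopless E"
    and "connected_graph E"
    and walk: "\<And>a b c d. (a, b) \<in> adjacency E \<Longrightarrow> (b, c) \<in> adjacency E \<Longrightarrow>
      (c, d) \<in> adjacency E \<Longrightarrow> (a, d) \<in> adjacency E"
  shows "complete_bipartite (E :: ('n::finite \<times> 'n) set)"
proof -
  let ?A = "adjacency E"
  obtain p q :: 'n where "p \<noteq> q"
    using assms(1) by (metis card_le_Suc0_iff_eq finite not_less_eq_eq numeral_2_eq_2)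
  moreover have "(p, q) \<in> ?A\<^sup>*"
    using assms(3) by (simp add: connected_graph_def)
  ultimately obtain w where pw: "(p, w) \<in> ?A"
    by (metis converse_rtranclE)
  define U where "U = {v. (v, w) \<in> ?A}"
  define W where "W = {v. (v, p) \<in> ?A}"
  \<comment> \<open>The walk \<open>b, a, w, p\<close> closes to an edge \<open>bp\<close>;
    \<open>WU\<close> is the mirror image with \<open>p\<close> and \<open>w\<close>
    exchanged.\<close>
  have UW: "b \<in> W" if "a \<in> U" "(a, b) \<in> ?A" for a b
    using that walk[of b a w p] pw by (simp add: U_def W_def adjacency_sym)
  have WU: "b \<in> U" if "a \<in> W" "(a, b) \<in> ?A" for a b
    using that walk[of b a p w] pw by (simp add: U_def W_def adjacency_sym)
  have "v \<in> U \<union> W" for v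
  proof -
    have "(p, v) \<in> ?A\<^sup>*"
      using assms(3) by (simp add: connected_graph_def)
    then show ?thesis
    proof induction
      case base
      then show ?case
        using pw by (simp add: U_def)
    next
      case (step y z)
      then show ?case
        using UW WU by blast
    qed
  qed
  then have cover: "U \<union> W = UNIV"
    by blast
  \<comment> \<open>A common neighbour of \<open>p\<close> and \<open>w\<close> would give a
    triangle, a walk from \<open>p\<close> back to \<open>p\<close> that closes to a loop.\<close>
  have "U \<inter> W = {}"
    using walk[of p _ w p] pw adjacency_irrefl[OF assms(2)]
    by (auto simp: U_def W_def adjacency_sym)
  moreover have "U \<times> W \<subseteq> ?A"
    using walk[of _ w p] pw by (auto simp: U_def W_def adjacency_sym)
  moreover from \<open>U \<times> W \<subseteq> ?A\<close> have "W \<times> U \<subseteq> ?A"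
    by (auto simp: adjacency_sym)
  moreover have "?A \<subseteq> U \<times> W \<union> W \<times> U"
    using cover UW WU by auto
  moreover have "p \<in> U" "w \<in> W"
    using pw by (simp_all add: U_def W_def adjacency_sym)
  ultimately show ?thesis
    using cover unfolding complete_bipartite_def
    by (intro exI[of _ U] exI[of _ W]) auto
qed

lemma adjacency_walk_closes:
  fixes E :: "('n::{finite,linorder} \<times> 'n) set"
  assumes "graph_index_set E" and "loopless E"
    and closed: "closedin (powertop_real E) (coord_proj E ` psd_rank_le_one)"
    and ab: "(a, b) \<in> adjacency E" and bc: "(b, c) \<in> adjacency E"
    and cd: "(c, d) \<in> adjacency E"
  shows "(a, d) \<in> adjacency E"
proof (rule ccontr)
  assume ad: "(a, d) \<notin> adjacency E"
  note irrefl = adjacency_irrefl[OF assms(2)]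
  \<comment> \<open>The case \<open>a = d\<close> stays open: it is the triangle.\<close>
  have disj: "a \<noteq> b" "c \<noteq> d" "a \<noteq> c" "b \<noteq> d" "b \<noteq> c"
    using ab bc cd ad irrefl by (auto simp: adjacency_sym)
  define x :: "real \<Rightarrow> (real, 'n) vec" where
    "x t = (\<chi> i. if i = a \<or> i = d then t else if i = b \<or> i = c then inverse t else 0)" for t
  define l :: "'n \<times> 'n \<Rightarrow> real" where
    "l = (\<lambda>(i, j)\<in>E. if (i \<in> {a, d} \<and> j \<in> {b, c}) \<or> (i \<in> {b, c} \<and> j \<in> {a, d}) then 1 else 0)"
  have inv: "((\<lambda>t::real. inverse t * inverse t) \<longlongrightarrow> 0) at_top"
    using tendsto_mult[OF tendsto_inverse_0_at_top[OF filterlim_ident]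
        tendsto_inverse_0_at_top[OF filterlim_ident]] by simp
  have lim: "((\<lambda>t. x t $ i * x t $ j) \<longlongrightarrow> l (i, j)) at_top" if ij: "(i, j) \<in> E" for i j
  proof -
    have "(i, j) \<in> adjacency E"
      using ij by (simp add: adjacency_def)
    \<comment> \<open>This rules out the divergent products \<open>t * t\<close>. The products left
      are \<open>1\<close>, \<open>inverse t * inverse t\<close> and \<open>0\<close>.\<close>
    then have "\<not> (i \<in> {a, d} \<and> j \<in> {a, d})"
      using ad irrefl adjacency_sym by (metis insertE singletonD)
    then consider "i \<in> {a, d} \<and> j \<in> {b, c} \<or> i \<in> {b, c} \<and> j \<in> {a, d}"
      | "i \<in> {b, c}" "j \<in> {b, c}"
      | "i \<notin> {a, b, c, d} \<or> j \<notin> {a, b, c, d}"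
      by blast
    then show ?thesis
    proof cases
      case 1
      then have "l (i, j) = 1"
        using ij by (auto simp: l_def)
      moreover have "x t $ i * x t $ j = 1" if "t > 0" for t
        using 1 disj that by (auto simp: x_def)
      ultimately have "\<forall>\<^sub>F t in at_top. x t $ i * x t $ j = l (i, j)"
        by (intro eventually_mono[OF eventually_gt_at_top[of 0]]) simp
      then show ?thesis
        by (rule tendsto_eventually)
    next
      case 2
      then have "l (i, j) = 0" "x t $ i * x t $ j = inverse t * inverse t" for t
        using ij disj by (auto simp: l_def x_def)
      then show ?thesis
        using inv by simp
    next
      case 3
      then have "l (i, j) = 0" "x t $ i * x t $ j = 0" for t
        using ij by (auto simp: l_def x_def)
      then show ?thesis
        by (simp only: tendsto_const)
    qed
  qed
  have "limitin (powertop_real E) (\<lambda>t. coord_proj E (outer (x t))) l at_top"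
    unfolding limitin_componentwise
    using lim by (auto simp: l_def coord_proj_def)
  then have "l \<in> coord_proj E ` psd_rank_le_one"
    by (rule limitin_closedin[OF _ closed])
      (auto simp: psd_rank_le_one_eq_range_outer)
  then obtain y where l: "l = coord_proj E (outer y)"
    by (auto simp: psd_rank_le_one_eq_range_outer)
  have y: "l (edge_coord i j) = y $ i * y $ j" "edge_coord i j \<in> E"
    if "(i, j) \<in> adjacency E" for i j
    using edge_coord_mem[OF assms(1) that] by (simp_all add: l coord_proj_outer_edge_coord)
  \<comment> \<open>The edges \<open>ab\<close> and \<open>cd\<close> force \<open>y $ b\<close> and
    \<open>y $ c\<close> to be nonzero, against the value \<open>0\<close> at
    \<open>bc\<close>.\<close>
  have "y $ a * y $ b = 1" "y $ c * y $ d = 1"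
    using y[OF ab] y[OF cd] by (auto simp: l_def edge_coord_def split: if_splits)
  moreover have "y $ b * y $ c = 0"
    using y[OF bc] disj by (auto simp: l_def edge_coord_def split: if_splits)
  ultimately show False
    by auto
qed

section \<open>The image for a complete bipartite graph\<close>

text \<open>The projection sees only the block between \<open>U\<close> and \<open>W\<close>.
  Vanishing minors let this block factor as a column times a row, and since \<open>U\<close> and
  \<open>W\<close> are disjoint both factors fit into one vector; hence positivity imposes no sign
  condition.\<close>

lemma complete_bipartite_image_eq:
  fixes E :: "('n::{finite,linorder} \<times> 'n) set"
  assumes "graph_index_set E"
    and disj: "U \<inter> W = {}"
    and adj: "adjacency E = U \<times> W \<union> W \<times> U"
  shows "coord_proj E ` psd_rank_le_one =
    {f \<in> topspace (powertop_real E). \<forall>u\<in>U. \<forall>u'\<in>U. \<forall>w\<in>W. \<forall>w'\<in>W.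
      f (edge_coord u w) * f (edge_coord u' w') = f (edge_coord u w') * f (edge_coord u' w)}"
    (is "_ = ?R")
proof (intro subset_antisym subsetI)
  have mem: "edge_coord u w \<in> E" if "u \<in> U" "w \<in> W" for u w
    using edge_coord_mem[OF assms(1)] adj that by blast
  fix f
  {
    assume "f \<in> coord_proj E ` psd_rank_le_one"
    then obtain x where "f = coord_proj E (outer x)"
      by (auto simp: psd_rank_le_one_eq_range_outer)
    then show "f \<in> ?R"
      using mem by (auto simp: coord_proj_outer_edge_coord) (simp add: coord_proj_def)
  next
    assume f: "f \<in> ?R"
    show "f \<in> coord_proj E ` psd_rank_le_one"
    proof -
      obtain x :: "(real, 'n) vec"
        where x: "\<And>u w. u \<in> U \<Longrightarrow> w \<in> W \<Longrightarrow> f (edge_coord u w) = x $ u * x $ w"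
      proof (cases "\<exists>u\<in>U. \<exists>w\<in>W. f (edge_coord u w) \<noteq> 0")
        case True
        then obtain p q where pq: "p \<in> U" "q \<in> W" "f (edge_coord p q) \<noteq> 0"
          by blast
        \<comment> \<open>Column \<open>q\<close> of the block on \<open>U\<close>, and row
          \<open>p\<close> divided by the pivot at \<open>pq\<close> on \<open>W\<close>; the minor
          through the pivot then gives every other entry.\<close>
        define x :: "(real, 'n) vec" where
          "x = (\<chi> i. if i \<in> U then f (edge_coord i q) else f (edge_coord p i) / f (edge_coord p q))"
        have "f (edge_coord u w) = x $ u * x $ w" if "u \<in> U" "w \<in> W" for u w
        proof -
          have "w \<notin> U"
            using that disj by blast
          moreover have "f (edge_coord u w) * f (edge_coord p q) = f (edge_coord u q) * f (edge_coord p w)"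
            using f that pq by blast
          ultimately show ?thesis
            using that pq by (simp add: x_def field_simps)
        qed
        then show thesis
          by (rule that)
      next
        case False
        then show thesis
          using that[of 0] by auto
      qed
      have "f (i, j) = x $ i * x $ j" if ij: "(i, j) \<in> E" for i j
      proof -
        have "i \<le> j"
          using assms(1) ij by (auto simp: graph_index_set_def)
        moreover have "i \<noteq> j" "i \<in> U \<and> j \<in> W \<or> i \<in> W \<and> j \<in> U"
          using ij adj disj by (auto simp: adjacency_def)
        ultimately show ?thesis
          using x[of i j] x[of j i] by (auto simp: edge_coord_def mult.commute)
      qed
      \<comment> \<open>Off \<open>E\<close> both functions are \<open>undefined\<close>, so
        agreement on \<open>E\<close> suffices for equality.\<close>
      moreover have "f \<in> extensional E"
        using f by (simp add: PiE_def)
      ultimately have "f = coord_proj E (outer x)"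
        by (auto simp: coord_proj_def restrict_def extensional_def fun_eq_iff)
      then show ?thesis
        by (auto simp: psd_rank_le_one_eq_range_outer)
    qed
  }
qed

text \<open>The minors are continuous in the coordinates, so the image is an intersection of closed
  zero sets.\<close>

lemma complete_bipartite_imp_closedin:
  fixes E :: "('n::{finite,linorder} \<times> 'n) set"
  assumes "graph_index_set E" and "complete_bipartite E"
  shows "closedin (powertop_real E) (coord_proj E ` psd_rank_le_one)"
proof -
  let ?T = "powertop_real E"
  obtain U W where UW: "U \<noteq> {}" "W \<noteq> {}" "U \<inter> W = {}" "adjacency E = U \<times> W \<union> W \<times> U"
    using assms(2) unfolding complete_bipartite_def by blast
  have mem: "edge_coord u w \<in> E" if "u \<in> U" "w \<in> W" for u w
    using edge_coord_mem[OF assms(1)] UW(4) that by blast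
  define minor where "minor = (\<lambda>(u, u', w, w') (f :: 'n \<times> 'n \<Rightarrow> real).
      f (edge_coord u w) * f (edge_coord u' w') - f (edge_coord u w') * f (edge_coord u' w))"
  let ?Z = "U \<times> U \<times> W \<times> W"
  have "closedin ?T {f \<in> topspace ?T. minor z f \<in> {0}}" if "z \<in> ?Z" for z
  proof -
    obtain u u' w w' where z: "z = (u, u', w, w')" "u \<in> U" "u' \<in> U" "w \<in> W" "w' \<in> W"
      using \<open>z \<in> ?Z\<close> by blast
    have "continuous_map ?T euclideanreal (minor z)"
      unfolding minor_def z(1) prod.case
      using mem z
      by (intro continuous_map_diff continuous_map_real_mult continuous_map_product_projection) auto
    then show ?thesis
      by (rule closedin_continuous_map_preimage) simp
  qed
  \<comment> \<open>Nonempty sides matter here: an intersection over no indices would be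
    \<open>UNIV\<close> instead of the topspace.\<close>
  then have "closedin ?T (\<Inter>z\<in>?Z. {f \<in> topspace ?T. minor z f \<in> {0}})"
    using UW(1,2) by (intro closedin_INT) auto
  also have "(\<Inter>z\<in>?Z. {f \<in> topspace ?T. minor z f \<in> {0}}) =
      {f \<in> topspace ?T. \<forall>z\<in>?Z. minor z f = 0}"
    using UW(1,2) by auto
  also have "\<dots> = coord_proj E ` psd_rank_le_one"
    unfolding complete_bipartite_image_eq[OF assms(1) UW(3,4)]
    by (rule Collect_cong) (simp add: minor_def)
  finally show ?thesis .
qed

theorem corollary3p2:
  fixes E :: "('n::{finite,linorder} \<times> 'n) set"
  assumes "CARD('n) \<ge> 2"
    and "graph_index_set E"
    and "loopless E"
    and "connected_graph E"
  shows "complete_bipartite E \<longleftrightarrow>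
    closedin (powertop_real E) (coord_proj E ` psd_rank_le_one)"
proof
  assume "complete_bipartite E"
  then show "closedin (powertop_real E) (coord_proj E ` psd_rank_le_one)"
    by (rule complete_bipartite_imp_closedin[OF assms(2)])
next
  assume "closedin (powertop_real E) (coord_proj E ` psd_rank_le_one)"
  then show "complete_bipartite E"
    using adjacency_walk_closes[OF assms(2,3)]
    by (intro complete_bipartite_if_walks_close[OF assms(1,3,4)]) blast
qed

end
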